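(* Let $R$ be an irreducible root system, let $k_c\ge0$ be given for each root length $c$, let $\rho=\sum_ck_c\rho_c$, and let $\lambda\in P^+$ be a dominant weight. Let $$\phi_\lambda=e^{i\lambda}+\sum_{\mu<\lambda}n_\mu e^{i\mu}\in\mathrm{trig}(P_\lambda)^W$$ (sum over $\mu\in P$) be the eigenfunction of $\tilde{\mathcal{H}}=-\Delta-\sum_c2k_c\nabla\log|A_c|$ with eigenvalue $(\lambda,\lambda+2\rho)$. Set $n_\lambda=1$ and $n_\nu=0$ for $\nu\not\le\lambda$. Then the remaining coefficients $n_\mu$, $\mu<\lambda$, are given by the following recursion formula, i.e. for every $\mu\in P$ with $\mu<\lambda$, $$\left(\|\lambda+\rho\|^2-\|\mu+\rho\|^2\right)n_\mu=2\sum_{\alpha\in R^+}\sum_{j\ge1}k_{\|\alpha\|}\,(\alpha,\mu+j\alpha)\,n_{\mu+j\alpha}.$$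
   Context: Let $V$ be a finite-dimensional real vector space with a positive-definite inner product $(\cdot,\cdot)$, used to identify $V$ with $V^*$; $\Delta$ and $\nabla$ are the corresponding Laplacian and gradient. For a smooth function $f$, the vector field $\nabla f$ acts as a differential operator by $\phi\mapsto(\nabla f,\nabla\phi)$ (with $(\cdot,\cdot)$ extended complex-bilinearly). For nonzero $\alpha\in V^*$ put $\breve\alpha=2\alpha/(\alpha,\alpha)$ and $s_\alpha(\beta)=\beta-(\breve\alpha,\beta)\alpha$. A root system is a finite spanning subset $R\subset V^*$ with $0\notin R$, $s_\alpha(R)\subset R$ and $(\breve\alpha,\beta)\in\mathbb{Z}$ for all $\alpha,\beta\in R$ (it need not be reduced). $P=\{\lambda\in V^*:(\breve\alpha,\lambda)\in\mathbb{Z}\ \forall\alpha\in R\}$ is the weight lattice and $W$ is the Weyl group. Fix an open Weyl chamber $C$; $R^+$ is the set of roots having positive inner product with all elements of $C$, and $P^+=P\cap\overline{C}$. The partial order on $P$ is: $\mu\le\lambda$ iff $\lambda-\mu$ is a sum of positive roots with non-negative integer coefficients. A root length is a number $c=\|\alpha\|$ with $\alpha\in R$; $R_c^+=\{\alpha\in R^+:\|\alpha\|=c\}$. Put $A_c=\prod_{\alpha\in R_c^+}\sin\frac{\alpha}{2}$ and $\rho_c=\frac12\sum_{\alpha\in R_c^+}\alpha$. Elements of $V^*$ are viewed as linear functions on $V$, and functions are considered on the fundamental alcove $A\subset V$ (the connected component of $V\setminus\bigcup_{\alpha\in R}\{u:\alpha(u)\in2\pi\mathbb{Z}\}$ contained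 in $C$ with the origin as a boundary point). For $W$-invariant $S\subset V^*$, $\mathrm{trig}(S)$ is the complex span of the functions $e^{i\lambda}$, $\lambda\in S$, with $W$ acting by $w\cdot e^{i\lambda}=e^{iw(\lambda)}$, and $\mathrm{trig}(S)^W$ is the subspace of invariants. For $\lambda\in P^+$, $P_\lambda=\bigcup_{w\in W}\{w(\mu):\mu\in P^+,\ \mu\le\lambda\}$. When all $k_c\ge0$, the function $\phi_\lambda$ is the unique element of $\mathrm{trig}(P_\lambda)^W$ with coefficient of $e^{i\lambda}$ equal to $1$ and $\tilde{\mathcal{H}}\phi_\lambda=(\lambda,\lambda+2\rho)\phi_\lambda$. *)

theory Defs
  imports "HOL-Analysis.Analysis"
begin

text \<open>
  The space \<open>V\<close> is a type of class \<open>euclidean_space\<close>; its dual is identified with \<open>V\<close> itself, so that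
  \<open>\<alpha>\<close> as a linear function on \<open>V\<close> is \<open>\<lambda>u. \<alpha> \<bullet> u\<close>.
\<close>

subsection \<open>Root systems\<close>

definition coroot :: "'a::euclidean_space \<Rightarrow> 'a" where
  "coroot \<alpha> = (2 / (\<alpha> \<bullet> \<alpha>)) *\<^sub>R \<alpha>"

definition root_reflection :: "'a::euclidean_space \<Rightarrow> 'a \<Rightarrow> 'a" where
  "root_reflection \<alpha> \<beta> = \<beta> - (coroot \<alpha> \<bullet> \<beta>) *\<^sub>R \<alpha>"

definition root_system :: "'a::euclidean_space set \<Rightarrow> bool" where
  "root_system R \<longleftrightarrow>
     finite R \<and> span R = UNIV \<and> 0 \<notin> R \<and>
     (\<forall>\<alpha>\<in>R. root_reflection \<alpha> ` R \<subseteq> R) \<and>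
     (\<forall>\<alpha>\<in>R. \<forall>\<beta>\<in>R. coroot \<alpha> \<bullet> \<beta> \<in> \<int>)"

definition irreducible_root_system :: "'a::euclidean_space set \<Rightarrow> bool" where
  "irreducible_root_system R \<longleftrightarrow>
     root_system R \<and> R \<noteq> {} \<and>
     \<not> (\<exists>R1 R2. R1 \<noteq> {} \<and> R2 \<noteq> {} \<and> R1 \<union> R2 = R \<and> R1 \<inter> R2 = {} \<and>
          (\<forall>\<alpha>\<in>R1. \<forall>\<beta>\<in>R2. \<alpha> \<bullet> \<beta> = 0))"

text \<open>Reflections are involutions, so the monoid they generate is already the group they generate.\<close>

inductive_set weyl_group :: "'a::euclidean_space set \<Rightarrow> ('a \<Rightarrow> 'a) set"
  for R :: "'a set" where
  weyl_id: "id \<in> weyl_group R"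
| weyl_reflection: "\<alpha> \<in> R \<Longrightarrow> w \<in> weyl_group R \<Longrightarrow> root_reflection \<alpha> \<circ> w \<in> weyl_group R"

definition weyl_chamber :: "'a::euclidean_space set \<Rightarrow> 'a set \<Rightarrow> bool" where
  "weyl_chamber R C \<longleftrightarrow> C \<in> components (UNIV - (\<Union>\<alpha>\<in>R. {x. \<alpha> \<bullet> x = 0}))"

definition fundamental_alcove :: "'a::euclidean_space set \<Rightarrow> 'a set \<Rightarrow> 'a set \<Rightarrow> bool" where
  "fundamental_alcove R C A \<longleftrightarrow>
     A \<in> components (UNIV - (\<Union>\<alpha>\<in>R. {u. \<exists>m::int. \<alpha> \<bullet> u = 2 * pi * of_int m})) \<and>
     A \<subseteq> C \<and> 0 \<in> frontier A"

definition positive_roots :: "'a::euclidean_space set \<Rightarrow> 'a set \<Rightarrow> 'a set" where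
  "positive_roots R C = {\<alpha>\<in>R. \<forall>x\<in>C. \<alpha> \<bullet> x > 0}"

definition weight_lattice :: "'a::euclidean_space set \<Rightarrow> 'a set" where
  "weight_lattice R = {\<mu>. \<forall>\<alpha>\<in>R. coroot \<alpha> \<bullet> \<mu> \<in> \<int>}"

definition dominant_weights :: "'a::euclidean_space set \<Rightarrow> 'a set \<Rightarrow> 'a set" where
  "dominant_weights R C = weight_lattice R \<inter> closure C"

definition weight_le :: "'a::euclidean_space set \<Rightarrow> 'a set \<Rightarrow> 'a \<Rightarrow> 'a \<Rightarrow> bool" where
  "weight_le R C \<mu> lam \<longleftrightarrow>
     (\<exists>m::'a \<Rightarrow> nat. lam - \<mu> = (\<Sum>\<alpha>\<in>positive_roots R C. real (m \<alpha>) *\<^sub>R \<alpha>))"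

definition weight_less :: "'a::euclidean_space set \<Rightarrow> 'a set \<Rightarrow> 'a \<Rightarrow> 'a \<Rightarrow> bool" where
  "weight_less R C \<mu> lam \<longleftrightarrow> weight_le R C \<mu> lam \<and> \<mu> \<noteq> lam"

text \<open>The set \<open>P\<^sub>\<lambda>\<close>.\<close>

definition saturated_weights :: "'a::euclidean_space set \<Rightarrow> 'a set \<Rightarrow> 'a \<Rightarrow> 'a set" where
  "saturated_weights R C lam =
     (\<Union>w\<in>weyl_group R. w ` {\<mu>\<in>dominant_weights R C. weight_le R C \<mu> lam})"

definition root_lengths :: "'a::euclidean_space set \<Rightarrow> real set" where
  "root_lengths R = norm ` R"

definition positive_roots_of_length :: "'a::euclidean_space set \<Rightarrow> 'a set \<Rightarrow> real \<Rightarrow> 'a set" where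
  "positive_roots_of_length R C c = {\<alpha>\<in>positive_roots R C. norm \<alpha> = c}"

definition rho_of_length :: "'a::euclidean_space set \<Rightarrow> 'a set \<Rightarrow> real \<Rightarrow> 'a" where
  "rho_of_length R C c = (1/2) *\<^sub>R (\<Sum>\<alpha>\<in>positive_roots_of_length R C c. \<alpha>)"

definition rho :: "'a::euclidean_space set \<Rightarrow> 'a set \<Rightarrow> (real \<Rightarrow> real) \<Rightarrow> 'a" where
  "rho R C k = (\<Sum>c\<in>root_lengths R. k c *\<^sub>R rho_of_length R C c)"

subsection \<open>Trigonometric polynomials\<close>

definition expi :: "'a::euclidean_space \<Rightarrow> 'a \<Rightarrow> complex" where
  "expi \<mu> u = exp (\<i> * complex_of_real (\<mu> \<bullet> u))"

text \<open>
  \<open>trig_invariants R S\<close> consists of the \<open>W\<close>-invariant elements of the complex span of the \<open>e\<^sup>i\<^sup>\<mu>\<close>, \<open>\<mu> \<in> S\<close>.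
  The action is \<open>w \<cdot> (\<Sum> a\<^sub>\<mu> e\<^sup>i\<^sup>\<mu>) = \<Sum> a\<^sub>\<mu> e\<^sup>i\<^sup>w\<^sup>\<mu>\<close>. It does not depend on the chosen expansion, because the
  exponentials are linearly independent; being analytic, they also stay independent on any
  nonempty open set, so nothing changes between functions on \<open>V\<close> and functions on the alcove.
\<close>

definition trig_invariants :: "'a::euclidean_space set \<Rightarrow> 'a set \<Rightarrow> ('a \<Rightarrow> complex) set" where
  "trig_invariants R S =
     {f. \<exists>F a. finite F \<and> F \<subseteq> S \<and> f = (\<lambda>u. \<Sum>\<mu>\<in>F. a \<mu> * expi \<mu> u) \<and>
          (\<forall>w\<in>weyl_group R. (\<lambda>u. \<Sum>\<mu>\<in>F. a \<mu> * expi (w \<mu>) u) = f)}"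

subsection \<open>The differential operator\<close>

definition gradient :: "('a::euclidean_space \<Rightarrow> real) \<Rightarrow> 'a \<Rightarrow> 'a" where
  "gradient f u = (THE D. GDERIV f u :> D)"

definition laplacian :: "('a::euclidean_space \<Rightarrow> complex) \<Rightarrow> 'a \<Rightarrow> complex" where
  "laplacian \<phi> u =
     (\<Sum>b\<in>Basis. frechet_derivative (\<lambda>x. frechet_derivative \<phi> (at x) b) (at u) b)"

text \<open>
  For real \<open>f\<close> and complex \<open>\<phi>\<close>, the complex-bilinear extension of the inner product gives
  \<open>(\<nabla>f, \<nabla>\<phi>) = (\<nabla>f, \<nabla> Re \<phi>) + \<i> (\<nabla>f, \<nabla> Im \<phi>)\<close>.
\<close>

definition gradient_field ::
  "('a::euclidean_space \<Rightarrow> real) \<Rightarrow> ('a \<Rightarrow> complex) \<Rightarrow> 'a \<Rightarrow> complex" where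
  "gradient_field f \<phi> u =
     Complex (gradient f u \<bullet> gradient (\<lambda>x. Re (\<phi> x)) u)
             (gradient f u \<bullet> gradient (\<lambda>x. Im (\<phi> x)) u)"

definition A_of_length :: "'a::euclidean_space set \<Rightarrow> 'a set \<Rightarrow> real \<Rightarrow> 'a \<Rightarrow> real" where
  "A_of_length R C c u = (\<Prod>\<alpha>\<in>positive_roots_of_length R C c. sin ((\<alpha> \<bullet> u) / 2))"

definition H_tilde ::
  "'a::euclidean_space set \<Rightarrow> 'a set \<Rightarrow> (real \<Rightarrow> real) \<Rightarrow> ('a \<Rightarrow> complex) \<Rightarrow> 'a \<Rightarrow> complex" where
  "H_tilde R C k \<phi> u =
     - laplacian \<phi> u
     - (\<Sum>c\<in>root_lengths R.
          complex_of_real (2 * k c) * gradient_field (\<lambda>x. ln \<bar>A_of_length R C c x\<bar>) \<phi> u)"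

end

theory Submission
  imports Defs
begin

text \<open>
  For a trigonometric polynomial \<open>\<phi> = \<Sum>\<^sub>x n\<^sub>x e\<^sup>i\<^sup>x\<close> the operator contributes, for each positive root,
  \<open>- k\<^sub>\<alpha> \<i> cot(\<alpha>/2) \<Sum>\<^sub>x (\<alpha>,x) n\<^sub>x e\<^sup>i\<^sup>x\<close>, where
  \<open>\<i> cot(\<alpha>/2) = - (1 + e\<^sup>-\<^sup>i\<^sup>\<alpha>) / (1 - e\<^sup>-\<^sup>i\<^sup>\<alpha>)\<close>. Invariance under \<open>s\<^sub>\<alpha>\<close> makes \<open>(\<alpha>,x) n\<^sub>x\<close> sum
  to zero along every \<open>\<alpha>\<close>-string, so the division by \<open>1 - e\<^sup>-\<^sup>i\<^sup>\<alpha>\<close> yields a trigonometric polynomial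
  again, with coefficients \<open>\<Sum>\<^sub>j\<^sub>\<ge>\<^sub>0 (\<alpha>, \<nu> + j\<alpha>) n\<^sub>\<nu>\<^sub>+\<^sub>j\<^sub>\<alpha>\<close>. Exponentials are linearly independent
  on the open alcove, so the recursion is the comparison of the coefficients of \<open>e\<^sup>i\<^sup>\<mu>\<close>.
\<close>

section \<open>Exponentials: derivatives and linear independence\<close>

lemma expi_add: "expi (\<mu> + \<nu>) u = expi \<mu> u * expi \<nu> u"
  by (simp add: expi_def inner_add_left distrib_left exp_add)

lemma expi_nonzero [simp]: "expi \<mu> u \<noteq> 0"
  by (simp add: expi_def)

lemma expi_has_derivative:
  "(expi \<mu> has_derivative (\<lambda>h. \<i> * complex_of_real (\<mu> \<bullet> h) * expi \<mu> u)) (at u)"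
proof -
  have "((\<lambda>u. exp (\<i> * complex_of_real (\<mu> \<bullet> u))) has_derivative
      (\<lambda>h. exp (\<i> * complex_of_real (\<mu> \<bullet> u)) * (\<i> * complex_of_real (\<mu> \<bullet> h)))) (at u)"
    by (auto intro!: derivative_eq_intros has_derivative_compose[OF _ DERIV_exp[unfolded has_field_derivative_def]])
  then show ?thesis
    by (simp add: expi_def[abs_def] mult_ac)
qed

lemma expi_sum_has_derivative:
  "((\<lambda>u. \<Sum>\<mu>\<in>F. a \<mu> * expi \<mu> u) has_derivative
     (\<lambda>h. \<Sum>\<mu>\<in>F. a \<mu> * (\<i> * complex_of_real (\<mu> \<bullet> h) * expi \<mu> u))) (at u)"
  by (intro has_derivative_sum has_derivative_mult_right expi_has_derivative)

text \<open>Induction on the frequencies. Dividing by e^(i\<nu>) makes the \<nu>-term constant, so a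
  directional derivative removes it and leaves a relation with one frequency fewer. Openness of
  \<open>S\<close> is what allows differentiating a relation known only on \<open>S\<close>.\<close>

lemma expi_independent:
  fixes F S :: "'a::euclidean_space set"
  assumes "finite F" "open S" "S \<noteq> {}"
    and "\<And>u. u \<in> S \<Longrightarrow> (\<Sum>\<mu>\<in>F. a \<mu> * expi \<mu> u) = 0"
  shows "\<forall>\<mu>\<in>F. a \<mu> = 0"
  using assms(1,4)
proof (induction F arbitrary: a rule: finite_induct)
  case (insert \<nu> F)
  have shifted: "(\<Sum>\<mu>\<in>F. a \<mu> * expi (\<mu> - \<nu>) u) = - a \<nu>" if "u \<in> S" for u
  proof -
    have "(\<Sum>\<mu>\<in>F. a \<mu> * expi (\<mu> - \<nu>) u) * expi \<nu> u = (\<Sum>\<mu>\<in>F. a \<mu> * expi \<mu> u)"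
      by (simp add: sum_distrib_right mult.assoc flip: expi_add)
    also have "\<dots> = - a \<nu> * expi \<nu> u"
      using insert.prems[OF that] insert.hyps by (simp add: add_eq_0_iff)
    finally show ?thesis by (metis expi_nonzero mult_right_cancel)
  qed
  have deriv0: "(\<Sum>\<mu>\<in>F. a \<mu> * complex_of_real ((\<mu> - \<nu>) \<bullet> b) * expi \<mu> u) = 0" if "u \<in> S" for u b
  proof -
    have "((\<lambda>u. \<Sum>\<mu>\<in>F. a \<mu> * expi (\<mu> - \<nu>) u) has_derivative
        (\<lambda>h. \<Sum>\<mu>\<in>F. a \<mu> * (\<i> * complex_of_real ((\<mu> - \<nu>) \<bullet> h) * expi (\<mu> - \<nu>) u))) (at u)"
      by (intro has_derivative_sum has_derivative_mult_right expi_has_derivative)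
    then have 1: "((\<lambda>u. - a \<nu>) has_derivative
        (\<lambda>h. \<Sum>\<mu>\<in>F. a \<mu> * (\<i> * complex_of_real ((\<mu> - \<nu>) \<bullet> h) * expi (\<mu> - \<nu>) u))) (at u)"
      by (rule has_derivative_transform_within_open[OF _ \<open>open S\<close> that]) (rule shifted)
    have "(\<lambda>h. \<Sum>\<mu>\<in>F. a \<mu> * (\<i> * complex_of_real ((\<mu> - \<nu>) \<bullet> h) * expi (\<mu> - \<nu>) u)) = (\<lambda>h. 0)"
      by (rule has_derivative_unique[OF 1]) (rule has_derivative_const)
    then have "(\<Sum>\<mu>\<in>F. a \<mu> * (\<i> * complex_of_real ((\<mu> - \<nu>) \<bullet> b) * expi (\<mu> - \<nu>) u)) = 0"
      by meson
    \<comment> \<open>The factor -\<i> e^(i\<nu>) undoes the shift of the frequencies and the \<i>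
      brought in by differentiation.\<close>
    then have "0 = (\<Sum>\<mu>\<in>F. a \<mu> * (\<i> * complex_of_real ((\<mu> - \<nu>) \<bullet> b) * expi (\<mu> - \<nu>) u)) * (- \<i> * expi \<nu> u)"
      by simp
    also have "\<dots> = (\<Sum>\<mu>\<in>F. a \<mu> * complex_of_real ((\<mu> - \<nu>) \<bullet> b) * expi \<mu> u)"
      unfolding sum_distrib_right
    proof (rule sum.cong)
      fix \<mu>
      have "expi \<mu> u = expi (\<mu> - \<nu>) u * expi \<nu> u" by (simp flip: expi_add)
      then show "a \<mu> * (\<i> * complex_of_real ((\<mu> - \<nu>) \<bullet> b) * expi (\<mu> - \<nu>) u) * (- \<i> * expi \<nu> u)
          = a \<mu> * complex_of_real ((\<mu> - \<nu>) \<bullet> b) * expi \<mu> u"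
        by (simp add: mult_ac)
    qed simp
    finally show ?thesis by simp
  qed
  have F0: "a \<mu> = 0" if "\<mu> \<in> F" for \<mu>
  proof -
    \<comment> \<open>With the direction \<mu> - \<nu>, the coefficient at \<mu> carries the factor
      (\<mu> - \<nu>, \<mu> - \<nu>), which is nonzero because \<nu> lies outside
      \<open>F\<close>.\<close>
    have "\<forall>\<kappa>\<in>F. a \<kappa> * complex_of_real ((\<kappa> - \<nu>) \<bullet> (\<mu> - \<nu>)) = 0"
      by (rule insert.IH) (rule deriv0)
    then have "a \<mu> * complex_of_real ((\<mu> - \<nu>) \<bullet> (\<mu> - \<nu>)) = 0" using that by blast
    moreover have "\<mu> \<noteq> \<nu>" using that insert.hyps by auto
    ultimately show ?thesis by simp
  qed
  moreover have "a \<nu> = 0"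
  proof -
    obtain u where "u \<in> S" using \<open>S \<noteq> {}\<close> by blast
    then show ?thesis using shifted[of u] F0 by simp
  qed
  ultimately show ?case by blast
qed simp

text \<open>Independence applied to the difference over \<open>F \<union> G\<close>. Extending
  coefficients by zero allows comparison of expansions over different index sets, such as the
  unspecified one supplied by \<open>trig_invariants\<close>.\<close>

lemma expi_sum_eq_coeffs:
  fixes F G :: "'a::euclidean_space set"
  assumes "finite F" "finite G" "(\<lambda>u. \<Sum>\<mu>\<in>F. a \<mu> * expi \<mu> u) = (\<lambda>u. \<Sum>\<mu>\<in>G. b \<mu> * expi \<mu> u)"
  shows "(if \<mu> \<in> F then a \<mu> else 0) = (if \<mu> \<in> G then b \<mu> else 0)"
proof (cases "\<mu> \<in> F \<union> G")
  case True
  define d where "d \<mu> = (if \<mu> \<in> F then a \<mu> else 0) - (if \<mu> \<in> G then b \<mu> else 0)" for \<mu>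
  have "\<forall>\<mu>\<in>F \<union> G. d \<mu> = 0"
  proof (rule expi_independent[where S = UNIV])
    fix u :: 'a
    have "(\<Sum>\<mu>\<in>F \<union> G. (if \<mu> \<in> F then a \<mu> else 0) * expi \<mu> u) = (\<Sum>\<mu>\<in>F. a \<mu> * expi \<mu> u)"
      using assms by (intro sum.mono_neutral_cong_right) auto
    moreover have "(\<Sum>\<mu>\<in>F \<union> G. (if \<mu> \<in> G then b \<mu> else 0) * expi \<mu> u) = (\<Sum>\<mu>\<in>G. b \<mu> * expi \<mu> u)"
      using assms by (intro sum.mono_neutral_cong_right) auto
    ultimately show "(\<Sum>\<mu>\<in>F \<union> G. d \<mu> * expi \<mu> u) = 0"
      using fun_cong[OF assms(3), of u] by (simp add: d_def left_diff_distrib sum_subtractf)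
  qed (use assms in auto)
  then show ?thesis using True by (auto simp: d_def)
qed auto

section \<open>The action of the differential operator on exponential sums\<close>

lemma laplacian_expi_sum:
  "laplacian (\<lambda>u. \<Sum>\<mu>\<in>F. a \<mu> * expi \<mu> u) u
     = - (\<Sum>\<mu>\<in>F. complex_of_real (\<mu> \<bullet> \<mu>) * a \<mu> * expi \<mu> u)"
proof -
  have 1: "frechet_derivative (\<lambda>u. \<Sum>\<mu>\<in>F. a \<mu> * expi \<mu> u) (at x) b
      = (\<Sum>\<mu>\<in>F. (a \<mu> * (\<i> * complex_of_real (\<mu> \<bullet> b))) * expi \<mu> x)" for a :: "'a \<Rightarrow> complex" and x b
    by (simp add: frechet_derivative_at[OF expi_sum_has_derivative, symmetric] mult.assoc)
  have "laplacian (\<lambda>u. \<Sum>\<mu>\<in>F. a \<mu> * expi \<mu> u) u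
      = (\<Sum>b\<in>Basis. \<Sum>\<mu>\<in>F. - (complex_of_real ((\<mu> \<bullet> b) * (\<mu> \<bullet> b)) * (a \<mu> * expi \<mu> u)))"
    unfolding laplacian_def 1
    by (intro sum.cong refl) (simp add: algebra_simps)
  also have "\<dots> = (\<Sum>\<mu>\<in>F. \<Sum>b\<in>Basis. - (complex_of_real ((\<mu> \<bullet> b) * (\<mu> \<bullet> b)) * (a \<mu> * expi \<mu> u)))"
    by (rule sum.swap)
  also have "\<dots> = (\<Sum>\<mu>\<in>F. - (complex_of_real (\<mu> \<bullet> \<mu>) * (a \<mu> * expi \<mu> u)))"
    by (intro sum.cong refl, subst (3) euclidean_inner)
       (simp add: sum_negf sum_distrib_right)
  finally show ?thesis by (simp add: sum_negf mult.assoc)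
qed

lemma gradient_eqI:
  assumes "GDERIV f u :> D"
  shows "gradient f u = D"
  unfolding gradient_def
proof (rule the_equality)
  fix E assume "GDERIV f u :> E"
  then have "(\<lambda>h. h \<bullet> E) = (\<lambda>h. h \<bullet> D)"
    using assms unfolding gderiv_def by (rule has_derivative_unique)
  then show "E = D" by (metis vector_eq_ldot)
qed (rule assms)

text \<open>A linear functional is represented by the vector of its values on the orthonormal basis;
  hence differentiability alone gives the existence that the definite description in
  \<open>gradient\<close> requires.\<close>

lemma gradient_inner:
  assumes "(f has_derivative f') (at u)"
  shows "D \<bullet> gradient f u = f' D"
proof -
  interpret bounded_linear f' by (rule has_derivative_bounded_linear[OF assms])
  have "f' h = h \<bullet> (\<Sum>b\<in>Basis. f' b *\<^sub>R b)" for h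
  proof -
    have "f' h = f' (\<Sum>b\<in>Basis. (h \<bullet> b) *\<^sub>R b)" by (simp add: euclidean_representation)
    also have "\<dots> = h \<bullet> (\<Sum>b\<in>Basis. f' b *\<^sub>R b)"
      by (simp add: sum scaleR inner_sum_right mult.commute)
    finally show ?thesis .
  qed
  then have f': "f' = (\<lambda>h. h \<bullet> (\<Sum>b\<in>Basis. f' b *\<^sub>R b))" by blast
  have "GDERIV f u :> (\<Sum>b\<in>Basis. f' b *\<^sub>R b)"
    unfolding gderiv_def using assms by (simp flip: f')
  then show ?thesis using f' by (metis gradient_eqI)
qed

text \<open>The real and imaginary parts in the definition recombine to the complex derivative, so
  the field can be applied to an exponential sum term by term.\<close>

lemma gradient_field_eq:
  assumes "GDERIV f u :> D" "(\<phi> has_derivative \<phi>') (at u)"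
  shows "gradient_field f \<phi> u = \<phi>' D"
proof -
  have "((\<lambda>x. Re (\<phi> x)) has_derivative (\<lambda>h. Re (\<phi>' h))) (at u)"
    "((\<lambda>x. Im (\<phi> x)) has_derivative (\<lambda>h. Im (\<phi>' h))) (at u)"
    using assms(2) by (auto intro: bounded_linear.has_derivative[OF bounded_linear_Re] bounded_linear.has_derivative[OF bounded_linear_Im])
  then show ?thesis
    by (simp add: gradient_field_def gradient_eqI[OF assms(1)] gradient_inner)
qed

lemma GDERIV_ln_abs_prod:
  assumes "finite I" "\<And>i. i \<in> I \<Longrightarrow> GDERIV (f i) u :> D i" "\<And>i. i \<in> I \<Longrightarrow> f i u \<noteq> 0"
  shows "GDERIV (\<lambda>x. ln \<bar>\<Prod>i\<in>I. f i x\<bar>) u :> (\<Sum>i\<in>I. (1 / f i u) *\<^sub>R D i)"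
proof -
  have "((\<lambda>x. \<Prod>i\<in>I. f i x) has_derivative
      (\<lambda>h. \<Sum>i\<in>I. (h \<bullet> D i) * (\<Prod>j\<in>I - {i}. f j u))) (at u)"
    using assms(2) unfolding gderiv_def by (rule has_derivative_prod)
  moreover have "(\<Sum>i\<in>I. (h \<bullet> D i) * (\<Prod>j\<in>I - {i}. f j u))
      = h \<bullet> ((\<Prod>i\<in>I. f i u) *\<^sub>R (\<Sum>i\<in>I. (1 / f i u) *\<^sub>R D i))" for h
    using assms by (auto simp: inner_sum_right sum_distrib_left prod.remove intro!: sum.cong)
  ultimately have P: "GDERIV (\<lambda>x. \<Prod>i\<in>I. f i x) u :> (\<Prod>i\<in>I. f i u) *\<^sub>R (\<Sum>i\<in>I. (1 / f i u) *\<^sub>R D i)"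
    by (simp add: gderiv_def)
  have nz: "(\<Prod>i\<in>I. f i u) \<noteq> 0" using assms by simp
  \<comment> \<open>Passing to the smooth function y^2 gives the derivative 1/y for both signs of y
    at once.\<close>
  have ln_abs: "(\<lambda>y::real. ln \<bar>y\<bar>) = (\<lambda>y. ln (y\<^sup>2) / 2)"
    by (simp add: fun_eq_iff abs_if ln_minus ln_realpow)
  have "((\<lambda>y. ln \<bar>y\<bar>) has_real_derivative inverse p) (at p)" if "p \<noteq> 0" for p :: real
  proof -
    have "0 < p * p" using that by (simp add: zero_less_mult_iff linorder_neq_iff disj_commute)
    then show ?thesis
      unfolding ln_abs using that by (auto intro!: derivative_eq_intros simp: field_simps power2_eq_square)
  qed
  from GDERIV_DERIV_compose[OF P this[OF nz]] show ?thesis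
    using nz by simp
qed

text \<open>The positive roots are partitioned by length. This turns the sums over \<open>c\<close>
  in the operator and in \<rho> into sums over roots weighted by k at the norm of the root.\<close>

lemma sum_root_lengths:
  assumes "finite R"
  shows "(\<Sum>c\<in>root_lengths R. \<Sum>\<alpha>\<in>positive_roots_of_length R C c. g c \<alpha>)
       = (\<Sum>\<alpha>\<in>positive_roots R C. g (norm \<alpha>) \<alpha>)"
proof -
  have "(\<Sum>c\<in>root_lengths R. \<Sum>\<alpha>\<in>positive_roots_of_length R C c. g c \<alpha>)
      = (\<Sum>c\<in>root_lengths R. \<Sum>\<alpha>\<in>{\<alpha>\<in>positive_roots R C. norm \<alpha> = c}. g (norm \<alpha>) \<alpha>)"
    by (intro sum.cong) (auto simp: positive_roots_of_length_def)
  also have "\<dots> = (\<Sum>\<alpha>\<in>positive_roots R C. g (norm \<alpha>) \<alpha>)"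
    using assms by (intro sum.group) (auto simp: positive_roots_def root_lengths_def)
  finally show ?thesis .
qed

lemma inner_rho:
  assumes "finite R"
  shows "2 * (v \<bullet> rho R C k) = (\<Sum>\<alpha>\<in>positive_roots R C. k (norm \<alpha>) * (\<alpha> \<bullet> v))"
  using sum_root_lengths[OF assms, where C = C and g = "\<lambda>c \<alpha>. k c * (\<alpha> \<bullet> v)"]
  by (simp add: rho_def rho_of_length_def inner_sum_right sum_distrib_left inner_commute)

text \<open>The gradient of ln |sin(\<alpha>/2)| is half of cot(\<alpha>/2) times \<alpha>. The half
  cancels the 2 in front of \<open>k c\<close>, and differentiating e^(i\<mu>) along \<alpha> yields
  \<i> (\<alpha>, \<mu>).\<close>

lemma H_tilde_expi_sum:
  assumes "finite R" and sin_nz: "\<And>\<alpha>. \<alpha> \<in> R \<Longrightarrow> sin ((\<alpha> \<bullet> u) / 2) \<noteq> 0"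
  shows "H_tilde R C k (\<lambda>u. \<Sum>\<mu>\<in>F. a \<mu> * expi \<mu> u) u
     = (\<Sum>\<mu>\<in>F. complex_of_real (\<mu> \<bullet> \<mu>) * a \<mu> * expi \<mu> u)
       - (\<Sum>\<alpha>\<in>positive_roots R C. complex_of_real (k (norm \<alpha>)) *
            (\<i> * complex_of_real (cot ((\<alpha> \<bullet> u) / 2)) *
              (\<Sum>\<mu>\<in>F. complex_of_real (\<alpha> \<bullet> \<mu>) * a \<mu> * expi \<mu> u)))"
proof -
  let ?\<phi> = "\<lambda>u. \<Sum>\<mu>\<in>F. a \<mu> * expi \<mu> u"
  let ?D = "\<lambda>\<alpha>. (cot ((\<alpha> \<bullet> u) / 2) / 2) *\<^sub>R \<alpha>"
  have grad: "gradient_field (\<lambda>x. ln \<bar>A_of_length R C c x\<bar>) ?\<phi> u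
      = (\<Sum>\<alpha>\<in>positive_roots_of_length R C c. complex_of_real (1/2) *
          (\<i> * complex_of_real (cot ((\<alpha> \<bullet> u) / 2)) *
            (\<Sum>\<mu>\<in>F. complex_of_real (\<alpha> \<bullet> \<mu>) * a \<mu> * expi \<mu> u)))" for c
  proof -
    have sub: "positive_roots_of_length R C c \<subseteq> R"
      by (auto simp: positive_roots_of_length_def positive_roots_def)
    have sin: "GDERIV (\<lambda>x. sin ((\<alpha> \<bullet> x) / 2)) u :> (cos ((\<alpha> \<bullet> u) / 2) / 2) *\<^sub>R \<alpha>" for \<alpha>
      unfolding gderiv_def by (auto intro!: derivative_eq_intros simp: inner_commute)
    have "GDERIV (\<lambda>x. ln \<bar>A_of_length R C c x\<bar>) u :>
        (\<Sum>\<alpha>\<in>positive_roots_of_length R C c.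
          (1 / sin ((\<alpha> \<bullet> u) / 2)) *\<^sub>R ((cos ((\<alpha> \<bullet> u) / 2) / 2) *\<^sub>R \<alpha>))"
      unfolding A_of_length_def
      by (rule GDERIV_ln_abs_prod) (use sub sin_nz sin \<open>finite R\<close> in \<open>auto intro: finite_subset\<close>)
    then have "GDERIV (\<lambda>x. ln \<bar>A_of_length R C c x\<bar>) u :> (\<Sum>\<alpha>\<in>positive_roots_of_length R C c. ?D \<alpha>)"
      by (simp add: cot_def)
    from gradient_field_eq[OF this expi_sum_has_derivative]
    have "gradient_field (\<lambda>x. ln \<bar>A_of_length R C c x\<bar>) ?\<phi> u
        = (\<Sum>\<mu>\<in>F. \<Sum>\<alpha>\<in>positive_roots_of_length R C c.
             a \<mu> * (\<i> * complex_of_real (\<mu> \<bullet> ?D \<alpha>) * expi \<mu> u))"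
      by (simp add: inner_sum_right sum_distrib_left sum_distrib_right)
    also have "\<dots> = (\<Sum>\<alpha>\<in>positive_roots_of_length R C c. \<Sum>\<mu>\<in>F.
             a \<mu> * (\<i> * complex_of_real (\<mu> \<bullet> ?D \<alpha>) * expi \<mu> u))"
      by (rule sum.swap)
    finally show ?thesis
      by (simp add: sum_distrib_left inner_commute mult_ac)
  qed
  show ?thesis
    unfolding H_tilde_def laplacian_expi_sum grad sum_distrib_left[where A = "positive_roots_of_length _ _ _"]
      sum_root_lengths[OF \<open>finite R\<close>]
    by (simp add: mult.assoc)
qed

section \<open>Sums along root strings\<close>

text \<open>The coefficient of e^(i\<nu>) in the quotient of the sum of (\<alpha>, x) n(x) e^(ix) by
  1 - e^(-i\<alpha>). Restricting to the support of \<open>n\<close> keeps this an ordinary finite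
  sum when the support is finite.\<close>

definition string_sum :: "('a::real_inner \<Rightarrow> complex) \<Rightarrow> 'a \<Rightarrow> 'a \<Rightarrow> complex" where
  "string_sum n \<alpha> \<nu> =
     (\<Sum>x | n x \<noteq> 0 \<and> (\<exists>j::nat. x = \<nu> + real j *\<^sub>R \<alpha>). complex_of_real (\<alpha> \<bullet> x) * n x)"

text \<open>Splitting off j = 0. Read as a statement on coefficients, this says that multiplying the
  quotient by 1 - e^(-i\<alpha>) gives back the dividend.\<close>

lemma string_sum_step:
  assumes "finite {x. n x \<noteq> 0}" "\<alpha> \<noteq> 0"
  shows "string_sum n \<alpha> \<nu> = complex_of_real (\<alpha> \<bullet> \<nu>) * n \<nu> + string_sum n \<alpha> (\<nu> + \<alpha>)"
proof -
  let ?U = "\<lambda>\<nu>. {x. n x \<noteq> 0 \<and> (\<exists>j::nat. x = \<nu> + real j *\<^sub>R \<alpha>)}"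
  have fin: "finite (?U \<kappa>)" for \<kappa> using assms(1) by (rule rev_finite_subset) auto
  have notin: "\<nu> \<notin> ?U (\<nu> + \<alpha>)"
  proof
    assume "\<nu> \<in> ?U (\<nu> + \<alpha>)"
    then obtain j :: nat where "\<nu> = \<nu> + \<alpha> + real j *\<^sub>R \<alpha>" by blast
    then have "(1 + real j) *\<^sub>R \<alpha> = 0" by (simp add: scaleR_add_left)
    with \<open>\<alpha> \<noteq> 0\<close> show False by simp
  qed
  have iff: "(\<exists>j::nat. x = \<nu> + real j *\<^sub>R \<alpha>) \<longleftrightarrow> x = \<nu> \<or> (\<exists>j::nat. x = \<nu> + \<alpha> + real j *\<^sub>R \<alpha>)" for x
  proof -
    have "(\<exists>j::nat. x = \<nu> + real j *\<^sub>R \<alpha>) \<longleftrightarrow> (\<exists>j. j = 0 \<and> x = \<nu> \<or> (\<exists>i. j = Suc i \<and> x = \<nu> + \<alpha> + real i *\<^sub>R \<alpha>))"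
      by (intro ex_cong1, case_tac j) (auto simp: scaleR_add_left add_ac)
    then show ?thesis by auto
  qed
  have "?U \<nu> = (if n \<nu> = 0 then {} else {\<nu>}) \<union> ?U (\<nu> + \<alpha>)"
    unfolding iff by auto
  then show ?thesis
    unfolding string_sum_def using fin notin by auto
qed

text \<open>Only finitely many terms are nonzero, so the infinite sum is a finite one. The start at
  \<mu> + \<alpha> accounts for the index beginning at 1, whereas \<open>string_sum\<close> begins
  at 0.\<close>

lemma infsum_string:
  assumes "finite {x. n x \<noteq> 0}" "\<alpha> \<noteq> 0"
  shows "(\<Sum>\<^sub>\<infinity>j\<in>{1::nat..}. complex_of_real (c * (\<alpha> \<bullet> (\<mu> + real j *\<^sub>R \<alpha>))) * n (\<mu> + real j *\<^sub>R \<alpha>))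
       = complex_of_real c * string_sum n \<alpha> (\<mu> + \<alpha>)"
proof -
  let ?U = "{x. n x \<noteq> 0 \<and> (\<exists>j::nat. x = \<mu> + \<alpha> + real j *\<^sub>R \<alpha>)}"
  let ?g = "\<lambda>j::nat. \<mu> + real j *\<^sub>R \<alpha>"
  let ?f = "\<lambda>x. complex_of_real (c * (\<alpha> \<bullet> x)) * n x"
  have fin: "finite ?U" using assms(1) by (rule rev_finite_subset) auto
  have inj: "inj_on ?g {1..}" using \<open>\<alpha> \<noteq> 0\<close> by (auto simp: inj_on_def)
  have sub: "?U \<subseteq> ?g ` {1..}"
  proof
    fix x assume "x \<in> ?U"
    then obtain j :: nat where "x = \<mu> + \<alpha> + real j *\<^sub>R \<alpha>" by blast
    then have "x = ?g (Suc j)" by (simp add: scaleR_add_left)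
    then show "x \<in> ?g ` {1..}" by (rule image_eqI) simp
  qed
  have zero: "?f x = 0" if "x \<in> ?g ` {1..} - ?U" for x
  proof -
    from that obtain j where j: "j \<ge> 1" "x = ?g j" by auto
    then have "x = \<mu> + \<alpha> + real (j - 1) *\<^sub>R \<alpha>" by (simp add: of_nat_diff scaleR_diff_left)
    with that show ?thesis by auto
  qed
  have "infsum (?f \<circ> ?g) {1..} = infsum ?f (?g ` {1..})"
    by (rule infsum_reindex[OF inj, symmetric])
  also have "\<dots> = infsum ?f ?U"
    using sub zero by (intro infsum_cong_neutral) auto
  also have "\<dots> = sum ?f ?U" using fin by simp
  finally show ?thesis
    by (simp add: o_def string_sum_def sum_distrib_left mult.assoc)
qed

lemma root_reflection_involution: "root_reflection \<alpha> (root_reflection \<alpha> x) = x"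
  by (cases "\<alpha> = 0") (simp_all add: root_reflection_def coroot_def inner_diff_right)

lemma inner_root_reflection: "\<alpha> \<bullet> root_reflection \<alpha> x = - (\<alpha> \<bullet> x)"
  by (cases "\<alpha> = 0") (simp_all add: root_reflection_def coroot_def inner_diff_right)

text \<open>Extended over a whole \<open>\<alpha>\<close>-string, the sum vanishes since \<open>s\<^sub>\<alpha>\<close> reverses the string.\<close>

lemma full_string_sum_zero:
  assumes inv: "\<And>x. n (root_reflection \<alpha> x) = n x"
    and "coroot \<alpha> \<bullet> \<nu> \<in> \<int>" "\<alpha> \<noteq> 0"
  shows "(\<Sum>x | n x \<noteq> 0 \<and> (\<exists>j::int. x = \<nu> + of_int j *\<^sub>R \<alpha>). complex_of_real (\<alpha> \<bullet> x) * n x) = 0"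
    (is "sum ?f ?L = 0")
proof -
  obtain m :: int where m: "coroot \<alpha> \<bullet> \<nu> = of_int m" using assms(2) by (rule Ints_cases)
  have "coroot \<alpha> \<bullet> \<alpha> = 2" using \<open>\<alpha> \<noteq> 0\<close> by (simp add: coroot_def)
  \<comment> \<open>On the index of the string the reflection acts as j \<mapsto> -m - j, an integer
    because \<nu> pairs integrally with the coroot.\<close>
  then have s: "root_reflection \<alpha> (\<nu> + of_int j *\<^sub>R \<alpha>) = \<nu> + of_int (- m - j) *\<^sub>R \<alpha>" for j :: int
    by (simp add: root_reflection_def inner_add_right m algebra_simps flip: scaleR_add_left)
  then have L: "root_reflection \<alpha> x \<in> ?L" if "x \<in> ?L" for x
  proof -
    obtain j :: int where j: "x = \<nu> + of_int j *\<^sub>R \<alpha>" and "n x \<noteq> 0" using \<open>x \<in> ?L\<close> by blast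
    then have "root_reflection \<alpha> x = \<nu> + of_int (- m - j) *\<^sub>R \<alpha>"
      using s[of j] by (simp only: j)
    moreover have "n (root_reflection \<alpha> x) \<noteq> 0" using \<open>n x \<noteq> 0\<close> inv by simp
    ultimately show ?thesis by blast
  qed
  have "sum ?f ?L = (\<Sum>x\<in>?L. ?f (root_reflection \<alpha> x))"
    by (rule sum.reindex_bij_witness[where i = "root_reflection \<alpha>" and j = "root_reflection \<alpha>"])
       (use L in \<open>auto simp: root_reflection_involution\<close>)
  also have "\<dots> = - sum ?f ?L"
    by (simp add: inv inner_root_reflection sum_negf)
  finally show ?thesis by simp
qed

text \<open>High up a string nothing of the support remains above \<nu>. Far down, the tail from
  \<nu> is the whole string, whose sum is zero by reflection symmetry. A nonzero value therefore
  needs support both strictly below \<nu> and at or above it, which confines \<nu> to a finite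
  set.\<close>

lemma finite_string_sum:
  assumes fin: "finite {x. n x \<noteq> 0}" and "\<alpha> \<noteq> 0"
    and inv: "\<And>x. n (root_reflection \<alpha> x) = n x"
    and int: "\<And>x. n x \<noteq> 0 \<Longrightarrow> coroot \<alpha> \<bullet> x \<in> \<int>"
  shows "finite {\<nu>. string_sum n \<alpha> \<nu> \<noteq> 0}"
proof -
  let ?G = "{x. n x \<noteq> 0}"
  obtain B where B: "\<And>x. x \<in> ?G \<Longrightarrow> norm x \<le> B"
    using finite_imp_bounded[OF fin] unfolding bounded_iff by blast
  \<comment> \<open>Two support points on a common \<alpha>-string are at distance at most 2B, hence
    at most 2B / |\<alpha>| steps apart.\<close>
  define N where "N = nat \<lceil>2 * B / norm \<alpha>\<rceil>"
  have "\<nu> \<in> (\<lambda>(x, j). x - real j *\<^sub>R \<alpha>) ` (?G \<times> {..N})" if nz: "string_sum n \<alpha> \<nu> \<noteq> 0" for \<nu>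
  proof -
    from nz obtain x where "x \<in> {x. n x \<noteq> 0 \<and> (\<exists>j::nat. x = \<nu> + real j *\<^sub>R \<alpha>)}"
      unfolding string_sum_def by (rule sum.not_neutral_contains_not_neutral)
    then obtain i :: nat where i: "n (\<nu> + real i *\<^sub>R \<alpha>) \<noteq> 0" by blast
    have "coroot \<alpha> \<bullet> \<alpha> = 2" using \<open>\<alpha> \<noteq> 0\<close> by (simp add: coroot_def)
    then have "coroot \<alpha> \<bullet> \<nu> = coroot \<alpha> \<bullet> (\<nu> + real i *\<^sub>R \<alpha>) - of_int (2 * int i)"
      by (simp add: inner_add_right)
    then have "coroot \<alpha> \<bullet> \<nu> \<in> \<int>" using int[OF i] by (metis Ints_diff Ints_of_int)
    note zero = full_string_sum_zero[of n \<alpha>, OF inv this \<open>\<alpha> \<noteq> 0\<close>]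
    \<comment> \<open>Otherwise the full string and its tail from \<nu> meet the support in the same
      set, and the tail sum would vanish.\<close>
    have "\<exists>j::int. j < 0 \<and> n (\<nu> + of_int j *\<^sub>R \<alpha>) \<noteq> 0"
    proof (rule ccontr)
      assume neg: "\<not> (\<exists>j::int. j < 0 \<and> n (\<nu> + of_int j *\<^sub>R \<alpha>) \<noteq> 0)"
      have "{x. n x \<noteq> 0 \<and> (\<exists>j::int. x = \<nu> + of_int j *\<^sub>R \<alpha>)}
          = {x. n x \<noteq> 0 \<and> (\<exists>j::nat. x = \<nu> + real j *\<^sub>R \<alpha>)}" (is "?L = ?U")
      proof
        show "?L \<subseteq> ?U"
        proof
          fix x assume x: "x \<in> ?L"
          then obtain j :: int where j: "x = \<nu> + of_int j *\<^sub>R \<alpha>" by blast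
          with x have "n (\<nu> + of_int j *\<^sub>R \<alpha>) \<noteq> 0" by simp
          with neg have "j \<ge> 0" by (meson not_less)
          then have "x = \<nu> + real (nat j) *\<^sub>R \<alpha>" using j by simp
          with x show "x \<in> ?U" by blast
        qed
        show "?U \<subseteq> ?L"
        proof
          fix x assume x: "x \<in> ?U"
          then obtain j :: nat where "x = \<nu> + real j *\<^sub>R \<alpha>" by blast
          then have "x = \<nu> + of_int (int j) *\<^sub>R \<alpha>" by simp
          with x show "x \<in> ?L" by blast
        qed
      qed
      with zero nz show False by (simp add: string_sum_def)
    qed
    then obtain j :: int where j: "j < 0" "n (\<nu> + of_int j *\<^sub>R \<alpha>) \<noteq> 0" by blast
    have "real i * norm \<alpha> \<le> (real i - of_int j) * norm \<alpha>"
      using j by (intro mult_right_mono) auto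
    also have "\<dots> = norm ((\<nu> + real i *\<^sub>R \<alpha>) - (\<nu> + of_int j *\<^sub>R \<alpha>))"
      using j by (simp flip: scaleR_diff_left)
    also have "\<dots> \<le> norm (\<nu> + real i *\<^sub>R \<alpha>) + norm (\<nu> + of_int j *\<^sub>R \<alpha>)"
      by (rule norm_triangle_ineq4)
    also have "\<dots> \<le> 2 * B" using B[of "\<nu> + real i *\<^sub>R \<alpha>"] B[of "\<nu> + of_int j *\<^sub>R \<alpha>"] i j by simp
    finally have "real i \<le> 2 * B / norm \<alpha>" using \<open>\<alpha> \<noteq> 0\<close> by (simp add: field_simps)
    then have "i \<le> N" unfolding N_def by linarith
    then show ?thesis using i by (intro image_eqI[of _ _ "(\<nu> + real i *\<^sub>R \<alpha>, i)"]) auto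
  qed
  then have "{\<nu>. string_sum n \<alpha> \<nu> \<noteq> 0} \<subseteq> (\<lambda>(x, j). x - real j *\<^sub>R \<alpha>) ` (?G \<times> {..N})" by blast
  then show ?thesis using fin by (auto intro: finite_subset)
qed

text \<open>With g the quotient, the sum on the left is (1 - e^(-i\<alpha>)) g, and the cotangent
  identity replaces that factor by -(1 + e^(-i\<alpha>)). The set \<open>T\<close> is left flexible
  so that one choice can serve all roots simultaneously.\<close>

lemma cot_mult_expi_sum:
  assumes finG: "finite {x. n x \<noteq> 0}" and "\<alpha> \<noteq> 0"
    and finT: "finite T" and T1: "{\<nu>. string_sum n \<alpha> \<nu> \<noteq> 0} \<subseteq> T"
    and T2: "{\<nu>. string_sum n \<alpha> (\<nu> + \<alpha>) \<noteq> 0} \<subseteq> T" and T3: "{x. n x \<noteq> 0} \<subseteq> T"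
    and "sin ((\<alpha> \<bullet> u) / 2) \<noteq> 0"
  shows "\<i> * complex_of_real (cot ((\<alpha> \<bullet> u) / 2)) *
           (\<Sum>x | n x \<noteq> 0. complex_of_real (\<alpha> \<bullet> x) * n x * expi x u)
       = - (\<Sum>\<nu>\<in>T. (string_sum n \<alpha> \<nu> + string_sum n \<alpha> (\<nu> + \<alpha>)) * expi \<nu> u)"
proof -
  let ?S = "string_sum n \<alpha>"
  have expi_shift: "expi \<nu> u = expi (- \<alpha>) u * expi (\<nu> + \<alpha>) u" for \<nu>
    by (simp flip: expi_add)
  have step: "complex_of_real (\<alpha> \<bullet> x) * n x = ?S x - ?S (x + \<alpha>)" for x
    using string_sum_step[OF finG \<open>\<alpha> \<noteq> 0\<close>, of x] by simp
  define g where "g = (\<Sum>\<nu>\<in>T. ?S \<nu> * expi \<nu> u)"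
  \<comment> \<open>\<open>T\<close> need not be stable under translation by \<alpha>, so the
    reindexing is done on the exact supports, both contained in \<open>T\<close> up to the
    shift.\<close>
  have "(\<Sum>\<nu>\<in>T. ?S (\<nu> + \<alpha>) * expi (\<nu> + \<alpha>) u) = (\<Sum>\<nu> | ?S (\<nu> + \<alpha>) \<noteq> 0. ?S (\<nu> + \<alpha>) * expi (\<nu> + \<alpha>) u)"
    using finT T2 by (intro sum.mono_neutral_right) auto
  also have "\<dots> = (\<Sum>\<nu> | ?S \<nu> \<noteq> 0. ?S \<nu> * expi \<nu> u)"
    by (rule sum.reindex_bij_witness[where i = "\<lambda>\<nu>. \<nu> - \<alpha>" and j = "\<lambda>\<nu>. \<nu> + \<alpha>"]) auto
  also have "\<dots> = g"
    unfolding g_def using finT T1 by (intro sum.mono_neutral_left) auto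
  finally have "expi (- \<alpha>) u * (\<Sum>\<nu>\<in>T. ?S (\<nu> + \<alpha>) * expi (\<nu> + \<alpha>) u) = expi (- \<alpha>) u * g"
    by simp
  then have shift: "(\<Sum>\<nu>\<in>T. ?S (\<nu> + \<alpha>) * expi \<nu> u) = expi (- \<alpha>) u * g"
    by (subst expi_shift) (simp add: sum_distrib_left mult.left_commute)
  have "(\<Sum>x | n x \<noteq> 0. complex_of_real (\<alpha> \<bullet> x) * n x * expi x u)
      = (\<Sum>x\<in>T. complex_of_real (\<alpha> \<bullet> x) * n x * expi x u)"
    using finT T3 by (intro sum.mono_neutral_left) auto
  also have "\<dots> = (\<Sum>x\<in>T. (?S x - ?S (x + \<alpha>)) * expi x u)"
    by (simp only: step)
  also have "\<dots> = (1 - expi (- \<alpha>) u) * g"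
    by (simp add: left_diff_distrib sum_subtractf shift g_def)
  finally have lhs: "(\<Sum>x | n x \<noteq> 0. complex_of_real (\<alpha> \<bullet> x) * n x * expi x u) = (1 - expi (- \<alpha>) u) * g" .
  have rhs: "(\<Sum>\<nu>\<in>T. (?S \<nu> + ?S (\<nu> + \<alpha>)) * expi \<nu> u) = (1 + expi (- \<alpha>) u) * g"
    by (simp add: distrib_right sum.distrib shift g_def)
  define \<theta> where "\<theta> = (\<alpha> \<bullet> u) / 2"
  have e: "expi (- \<alpha>) u = Complex (cos (2 * \<theta>)) (- sin (2 * \<theta>))"
    by (simp add: expi_def \<theta>_def complex_eq_iff Re_exp Im_exp)
  have "\<i> * complex_of_real (cot \<theta>) * (1 - expi (- \<alpha>) u) = - (1 + expi (- \<alpha>) u)"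
    using \<open>sin ((\<alpha> \<bullet> u) / 2) \<noteq> 0\<close> unfolding e \<theta>_def[symmetric] sin_double cos_double_sin
    by (simp add: complex_eq_iff cot_def field_simps power2_eq_square)
       (use sin_cos_squared_add3[of \<theta>] in linarith)
  then show ?thesis unfolding lhs rhs \<theta>_def
    by (metis mult.assoc mult_minus_left)
qed

section \<open>The alcove and the invariance of coefficients\<close>

lemma open_alcove:
  assumes "finite R" "fundamental_alcove R C A"
  shows "open A"
proof -
  \<comment> \<open>For a fixed root these are infinitely many hyperplanes; their union is closed as
    the preimage of the closed set of integers under \<alpha>/(2 pi).\<close>
  have "closed {u. \<exists>m::int. \<alpha> \<bullet> u = 2 * pi * of_int m}" for \<alpha> :: 'a
  proof -
    have "closed ((\<lambda>u. (\<alpha> \<bullet> u) / (2 * pi)) -` \<int>)"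
      by (intro closed_vimage closed_Ints continuous_intros) auto
    moreover have "(\<lambda>u. (\<alpha> \<bullet> u) / (2 * pi)) -` \<int> = {u. \<exists>m::int. \<alpha> \<bullet> u = 2 * pi * of_int m}"
      by (auto simp: Ints_def field_simps)
    ultimately show ?thesis by simp
  qed
  then have "open (UNIV - (\<Union>\<alpha>\<in>R. {u. \<exists>m::int. \<alpha> \<bullet> u = 2 * pi * of_int m}))"
    using \<open>finite R\<close> by (intro open_Diff) auto
  then show ?thesis
    using assms(2) unfolding fundamental_alcove_def by (blast intro: open_components)
qed

lemma sin_nonzero_on_alcove:
  assumes "fundamental_alcove R C A" "\<alpha> \<in> R" "u \<in> A"
  shows "sin ((\<alpha> \<bullet> u) / 2) \<noteq> 0"
proof
  assume "sin ((\<alpha> \<bullet> u) / 2) = 0"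
  then obtain m :: int where "(\<alpha> \<bullet> u) / 2 = of_int m * pi" by (auto simp: sin_zero_iff_int2)
  then have "\<alpha> \<bullet> u = 2 * pi * of_int m" by simp
  with assms show False
    unfolding fundamental_alcove_def by (blast dest: in_components_subset)
qed

text \<open>Membership provides invariance only for some expansion of the function. Linear
  independence identifies its coefficients with \<open>b\<close>, once directly and once after
  reindexing by the reflection.\<close>

lemma trig_invariants_coeff:
  fixes R :: "'a::euclidean_space set"
  assumes inv: "(\<lambda>u. \<Sum>x | b x \<noteq> 0. b x * expi x u) \<in> trig_invariants R S"
    and fin: "finite {x. b x \<noteq> 0}" and "\<alpha> \<in> R"
  shows "b (root_reflection \<alpha> x) = b x"
proof -
  let ?s = "root_reflection \<alpha>"
  let ?\<phi> = "\<lambda>u. \<Sum>x | b x \<noteq> 0. b x * expi x u"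
  obtain F a where F: "finite F" "?\<phi> = (\<lambda>u. \<Sum>\<mu>\<in>F. a \<mu> * expi \<mu> u)"
    and w: "\<And>w. w \<in> weyl_group R \<Longrightarrow> (\<lambda>u. \<Sum>\<mu>\<in>F. a \<mu> * expi (w \<mu>) u) = ?\<phi>"
    using inv unfolding trig_invariants_def by blast
  have "?s \<in> weyl_group R"
    using weyl_reflection[OF \<open>\<alpha> \<in> R\<close> weyl_id] by simp
  then have "(\<lambda>u. \<Sum>\<mu>\<in>F. a \<mu> * expi (?s \<mu>) u) = ?\<phi>" by (rule w)
  moreover have "(\<Sum>\<mu>\<in>F. a \<mu> * expi (?s \<mu>) u) = (\<Sum>\<mu>\<in>?s ` F. a (?s \<mu>) * expi \<mu> u)" for u
    by (rule sum.reindex_bij_witness[where i = ?s and j = ?s]) (auto simp: root_reflection_involution)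
  ultimately have "(\<lambda>u. \<Sum>\<mu>\<in>?s ` F. a (?s \<mu>) * expi \<mu> u) = ?\<phi>" by simp
  from expi_sum_eq_coeffs[OF finite_imageI[OF F(1)] fin this, of "?s x"]
    expi_sum_eq_coeffs[OF F(1) fin F(2)[symmetric], of x]
  show ?thesis
    by (auto simp: root_reflection_involution image_iff split: if_splits)
       (metis root_reflection_involution)+
qed

section \<open>Comparison of coefficients in the eigenvalue equation\<close>

theorem proposition19:
  fixes R C A :: "'a::euclidean_space set"
    and k :: "real \<Rightarrow> real"
    and lam :: 'a
    and n :: "'a \<Rightarrow> complex"
    and \<phi> :: "'a \<Rightarrow> complex"
  assumes "irreducible_root_system R"
    and "weyl_chamber R C"
    and "fundamental_alcove R C A"
    and "\<And>c. c \<in> root_lengths R \<Longrightarrow> k c \<ge> 0"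
    and "lam \<in> dominant_weights R C"
    and "finite {\<mu> \<in> weight_lattice R. weight_less R C \<mu> lam \<and> n \<mu> \<noteq> 0}"
    and "\<phi> = (\<lambda>u. expi lam u +
               (\<Sum>\<mu> \<in> {\<mu> \<in> weight_lattice R. weight_less R C \<mu> lam \<and> n \<mu> \<noteq> 0}. n \<mu> * expi \<mu> u))"
    and "\<phi> \<in> trig_invariants R (saturated_weights R C lam)"
    and "\<And>u. u \<in> A \<Longrightarrow>
           H_tilde R C k \<phi> u = complex_of_real (lam \<bullet> (lam + 2 *\<^sub>R rho R C k)) * \<phi> u"
    and "n lam = 1"
    and "\<And>\<nu>. \<nu> \<in> weight_lattice R \<Longrightarrow> \<not> weight_le R C \<nu> lam \<Longrightarrow> n \<nu> = 0"
  shows "\<forall>\<mu> \<in> weight_lattice R. weight_less R C \<mu> lam \<longrightarrow>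
           complex_of_real ((norm (lam + rho R C k))\<^sup>2 - (norm (\<mu> + rho R C k))\<^sup>2) * n \<mu> =
           2 * (\<Sum>\<alpha>\<in>positive_roots R C. \<Sum>\<^sub>\<infinity>j\<in>{1::nat..}.
                  complex_of_real (k (norm \<alpha>) * (\<alpha> \<bullet> (\<mu> + real j *\<^sub>R \<alpha>))) * n (\<mu> + real j *\<^sub>R \<alpha>))"
proof (intro ballI impI)
  fix \<mu>
  assume \<mu>: "\<mu> \<in> weight_lattice R" "weight_less R C \<mu> lam"
  let ?F = "{\<mu> \<in> weight_lattice R. weight_less R C \<mu> lam \<and> n \<mu> \<noteq> 0}"
  have R: "finite R" "0 \<notin> R" and coroot_int: "\<And>\<alpha> \<beta>. \<alpha> \<in> R \<Longrightarrow> \<beta> \<in> R \<Longrightarrow> coroot \<alpha> \<bullet> \<beta> \<in> \<int>"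
    using assms(1) by (auto simp: irreducible_root_system_def root_system_def)
  have pos: "finite (positive_roots R C)" "positive_roots R C \<subseteq> R"
    using R by (auto simp: positive_roots_def)
  have lam: "lam \<in> weight_lattice R"
    using assms(5) by (simp add: dominant_weights_def)
  \<comment> \<open>Nothing is assumed about \<open>n\<close> off the weight lattice, so it is cut
    off there; \<open>b\<close> then has finite support and is the actual coefficient function of
    \<phi>.\<close>
  define b where "b x = (if x \<in> weight_lattice R then n x else 0)" for x
  have supp: "{x. b x \<noteq> 0} = insert lam ?F"
    using lam assms(10,11) by (auto simp: b_def weight_less_def)
  then have fin: "finite {x. b x \<noteq> 0}"
    using assms(6) by simp
  have \<phi>: "\<phi> = (\<lambda>u. \<Sum>x | b x \<noteq> 0. b x * expi x u)"
  proof
    fix u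
    have "lam \<notin> ?F" by (simp add: weight_less_def)
    moreover have "b lam = 1" using lam assms(10) by (simp add: b_def)
    moreover have "(\<Sum>x\<in>?F. n x * expi x u) = (\<Sum>x\<in>?F. b x * expi x u)"
      by (intro sum.cong) (auto simp: b_def)
    ultimately show "\<phi> u = (\<Sum>x | b x \<noteq> 0. b x * expi x u)"
      unfolding supp using assms(6) by (simp add: assms(7))
  qed
  have refl: "b (root_reflection \<alpha> x) = b x" if "\<alpha> \<in> R" for \<alpha> x
    using assms(8) fin that unfolding \<phi> by (rule trig_invariants_coeff)
  have fin_string: "finite {\<nu>. string_sum b \<alpha> \<nu> \<noteq> 0}" if "\<alpha> \<in> R" for \<alpha>
  proof (rule finite_string_sum[OF fin])
    show "\<alpha> \<noteq> 0" using that R by blast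
    show "coroot \<alpha> \<bullet> x \<in> \<int>" if "b x \<noteq> 0" for x
      using that \<open>\<alpha> \<in> R\<close> by (auto simp: b_def weight_lattice_def split: if_splits)
  qed (rule refl[OF that])
  \<comment> \<open>One finite set carrying every exponential that occurs for any root. Inserting
    \<mu> makes the comparison at \<mu> available even where all these coefficients vanish.\<close>
  define T where "T = insert \<mu> ({x. b x \<noteq> 0} \<union>
    (\<Union>\<alpha>\<in>R. {\<nu>. string_sum b \<alpha> \<nu> \<noteq> 0} \<union> {\<nu>. string_sum b \<alpha> (\<nu> + \<alpha>) \<noteq> 0}))"
  have fin_shift: "finite {\<nu>. string_sum b \<alpha> (\<nu> + \<alpha>) \<noteq> 0}" if "\<alpha> \<in> R" for \<alpha>
  proof -
    have "{\<nu>. string_sum b \<alpha> (\<nu> + \<alpha>) \<noteq> 0} = (\<lambda>\<nu>. \<nu> - \<alpha>) ` {\<nu>. string_sum b \<alpha> \<nu> \<noteq> 0}"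
      by (auto simp: image_iff intro!: exI[of _ "_ + \<alpha>"])
    then show ?thesis using fin_string[OF that] by simp
  qed
  have "finite T"
    unfolding T_def using R fin fin_string fin_shift by auto
  let ?k = "\<lambda>\<alpha>. complex_of_real (k (norm \<alpha>))"
  let ?\<Lambda> = "complex_of_real (lam \<bullet> (lam + 2 *\<^sub>R rho R C k))"
  \<comment> \<open>The coefficient of e^(i\<nu>) in the operator applied to \<phi> minus the
    eigenvalue times \<phi>.\<close>
  define d where "d \<nu> = complex_of_real (\<nu> \<bullet> \<nu>) * b \<nu>
    + (\<Sum>\<alpha>\<in>positive_roots R C. ?k \<alpha> * (string_sum b \<alpha> \<nu> + string_sum b \<alpha> (\<nu> + \<alpha>)))
    - ?\<Lambda> * b \<nu>" for \<nu>
  have "\<forall>\<nu>\<in>T. d \<nu> = 0"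
  proof (rule expi_independent[OF \<open>finite T\<close>])
    show "open A" using R(1) assms(3) by (rule open_alcove)
    show "A \<noteq> {}" using assms(3) by (auto simp: fundamental_alcove_def)
    fix u assume u: "u \<in> A"
    have sin_nz: "sin ((\<alpha> \<bullet> u) / 2) \<noteq> 0" if "\<alpha> \<in> R" for \<alpha>
      using assms(3) that u by (rule sin_nonzero_on_alcove)
    have suppT: "(\<Sum>x | b x \<noteq> 0. c x * b x * expi x u) = (\<Sum>x\<in>T. c x * b x * expi x u)" for c
      using \<open>finite T\<close> by (intro sum.mono_neutral_left) (auto simp: T_def)
    have cot: "\<i> * complex_of_real (cot ((\<alpha> \<bullet> u) / 2)) *
           (\<Sum>x | b x \<noteq> 0. complex_of_real (\<alpha> \<bullet> x) * b x * expi x u)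
       = - (\<Sum>\<nu>\<in>T. (string_sum b \<alpha> \<nu> + string_sum b \<alpha> (\<nu> + \<alpha>)) * expi \<nu> u)"
      if "\<alpha> \<in> positive_roots R C" for \<alpha>
      by (rule cot_mult_expi_sum) (use that pos R fin \<open>finite T\<close> sin_nz in \<open>auto simp: T_def\<close>)
    have H: "H_tilde R C k \<phi> u
     = (\<Sum>\<mu> | b \<mu> \<noteq> 0. complex_of_real (\<mu> \<bullet> \<mu>) * b \<mu> * expi \<mu> u)
       - (\<Sum>\<alpha>\<in>positive_roots R C. ?k \<alpha> *
            (\<i> * complex_of_real (cot ((\<alpha> \<bullet> u) / 2)) *
              (\<Sum>\<mu> | b \<mu> \<noteq> 0. complex_of_real (\<alpha> \<bullet> \<mu>) * b \<mu> * expi \<mu> u)))"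
      unfolding \<phi> using R(1) sin_nz by (rule H_tilde_expi_sum)
    have "(\<Sum>x\<in>T. ?\<Lambda> * b x * expi x u) = ?\<Lambda> * \<phi> u"
      unfolding \<phi> suppT[of "\<lambda>x. ?\<Lambda>", symmetric] by (simp add: sum_distrib_left mult.assoc)
    also have "\<dots> = H_tilde R C k \<phi> u"
      using assms(9)[OF u] by simp
    also have "\<dots> = (\<Sum>x\<in>T. complex_of_real (x \<bullet> x) * b x * expi x u)
        + (\<Sum>\<alpha>\<in>positive_roots R C. ?k \<alpha> *
            (\<Sum>\<nu>\<in>T. (string_sum b \<alpha> \<nu> + string_sum b \<alpha> (\<nu> + \<alpha>)) * expi \<nu> u))"
      unfolding H suppT[of "\<lambda>x. complex_of_real (x \<bullet> x)"]
      by (simp add: cot sum_negf)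
    also have "(\<Sum>\<alpha>\<in>positive_roots R C. ?k \<alpha> *
            (\<Sum>\<nu>\<in>T. (string_sum b \<alpha> \<nu> + string_sum b \<alpha> (\<nu> + \<alpha>)) * expi \<nu> u))
        = (\<Sum>\<nu>\<in>T. (\<Sum>\<alpha>\<in>positive_roots R C. ?k \<alpha> * (string_sum b \<alpha> \<nu> + string_sum b \<alpha> (\<nu> + \<alpha>))) * expi \<nu> u)"
      unfolding sum_distrib_left sum_distrib_right
      by (subst sum.swap) (simp add: mult.assoc)
    finally show "(\<Sum>\<nu>\<in>T. d \<nu> * expi \<nu> u) = 0"
      by (simp add: d_def distrib_right left_diff_distrib sum.distrib sum_subtractf)
  qed
  then have "d \<mu> = 0" by (simp add: T_def)
  have b\<mu>: "b \<mu> = n \<mu>" using \<mu> by (simp add: b_def)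
  \<comment> \<open>Expressing the tail from \<mu> through the tail from \<mu> + \<alpha> produces
    the factor 2 of the recursion. The split-off terms (\<alpha>, \<mu>) n(\<mu>), weighted and
    summed over the positive roots, give 2 (\<mu>, \<rho>) n(\<mu>).\<close>
  have string: "?k \<alpha> * (string_sum b \<alpha> \<mu> + string_sum b \<alpha> (\<mu> + \<alpha>))
      = complex_of_real (k (norm \<alpha>) * (\<alpha> \<bullet> \<mu>)) * n \<mu> + 2 * (?k \<alpha> * string_sum b \<alpha> (\<mu> + \<alpha>))"
    if "\<alpha> \<in> positive_roots R C" for \<alpha>
  proof -
    have "\<alpha> \<noteq> 0" using that pos R by blast
    then show ?thesis
      using string_sum_step[OF fin, of \<alpha> \<mu>] by (simp add: b\<mu> algebra_simps)
  qed
  have "(\<Sum>\<alpha>\<in>positive_roots R C. ?k \<alpha> * (string_sum b \<alpha> \<mu> + string_sum b \<alpha> (\<mu> + \<alpha>)))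
      = complex_of_real (2 * (\<mu> \<bullet> rho R C k)) * n \<mu>
        + 2 * (\<Sum>\<alpha>\<in>positive_roots R C. ?k \<alpha> * string_sum b \<alpha> (\<mu> + \<alpha>))"
    unfolding inner_rho[OF R(1)]
    by (simp add: string sum.distrib sum_distrib_left sum_distrib_right)
  with \<open>d \<mu> = 0\<close> have eq: "(?\<Lambda> - complex_of_real (\<mu> \<bullet> \<mu> + 2 * (\<mu> \<bullet> rho R C k))) * n \<mu>
      = 2 * (\<Sum>\<alpha>\<in>positive_roots R C. ?k \<alpha> * string_sum b \<alpha> (\<mu> + \<alpha>))"
    by (simp add: d_def b\<mu> algebra_simps)
  \<comment> \<open>Completing the square: the terms (\<rho>, \<rho>) cancel in the
    difference.\<close>
  have norms: "(norm (lam + rho R C k))\<^sup>2 - (norm (\<mu> + rho R C k))\<^sup>2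
      = lam \<bullet> (lam + 2 *\<^sub>R rho R C k) - (\<mu> \<bullet> \<mu> + 2 * (\<mu> \<bullet> rho R C k))"
    by (simp add: power2_norm_eq_inner inner_add_left inner_add_right inner_commute)
  \<comment> \<open>Roots are themselves weights, so the string through \<mu> stays in the lattice,
    where \<open>b\<close> agrees with \<open>n\<close>.\<close>
  have lattice: "\<mu> + real j *\<^sub>R \<alpha> \<in> weight_lattice R" if "\<alpha> \<in> R" for \<alpha> j
    using \<mu>(1) coroot_int that
    by (auto simp: weight_lattice_def inner_add_right intro!: Ints_add Ints_mult)
  have "(\<Sum>\<^sub>\<infinity>j\<in>{1::nat..}. complex_of_real (k (norm \<alpha>) * (\<alpha> \<bullet> (\<mu> + real j *\<^sub>R \<alpha>))) * n (\<mu> + real j *\<^sub>R \<alpha>))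
      = ?k \<alpha> * string_sum b \<alpha> (\<mu> + \<alpha>)" if "\<alpha> \<in> positive_roots R C" for \<alpha>
  proof -
    have \<alpha>: "\<alpha> \<in> R" "\<alpha> \<noteq> 0" using that pos R by auto
    have "b (\<mu> + real j *\<^sub>R \<alpha>) = n (\<mu> + real j *\<^sub>R \<alpha>)" for j
      using lattice[OF \<alpha>(1)] by (simp add: b_def)
    then show ?thesis
      using infsum_string[OF fin \<alpha>(2), of "k (norm \<alpha>)" \<mu>] by simp
  qed
  then show "complex_of_real ((norm (lam + rho R C k))\<^sup>2 - (norm (\<mu> + rho R C k))\<^sup>2) * n \<mu> =
           2 * (\<Sum>\<alpha>\<in>positive_roots R C. \<Sum>\<^sub>\<infinity>j\<in>{1::nat..}.
                  complex_of_real (k (norm \<alpha>) * (\<alpha> \<bullet> (\<mu> + real j *\<^sub>R \<alpha>))) * n (\<mu> + real j *\<^sub>R \<alpha>))"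
    using eq unfolding norms by simp
qed

end
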